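(* Let $q$ be an odd prime, and suppose $k, y$ are positive integers with \[ (2^{k}-1)(3^{k}-1)=y^{q}. \] Then $q \mid k$. *)

theory Defs
  imports "HOL-Number_Theory.Number_Theory"
begin

end

theory Submission
  imports Defs
begin

text \<open>
  Comparing exponents of 2 and 3 on both sides shows \<open>q \<le> v\<^sub>2(k) + 2\<close> and
  \<open>q \<le> v\<^sub>3(k) + 1\<close>. For a prime \<open>p \<ge> 5\<close> with \<open>p - 1\<close> dividing \<open>k\<close>, lifting the exponent
  gives \<open>v\<^sub>p(y^q) = c + 2 v\<^sub>p(k)\<close>, where \<open>p^c\<close> divides \<open>(2^(p-1) - 1) (3^(p-1) - 1) < p^p\<close>; so
  \<open>q < p + 2 v\<^sub>p(k)\<close>. Climbing through the primes \<open>p \<le> q\<close>, these bounds on the exponents at the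
  primes dividing \<open>p - 1\<close> yield \<open>p - 1\<close> dividing \<open>k\<close>. For \<open>p = q\<close> the bound reads
  \<open>v\<^sub>q(k) > 0\<close>.
\<close>

section \<open>Lifting the exponent\<close>

text \<open>With \<open>Y = 1 + p * t\<close>, the binomial expansion modulo \<open>p^2\<close>
  stops at the linear term, so the sum is \<open>p\<close> plus \<open>p * t\<close> times the sum
  of the indices; that second term vanishes modulo \<open>p^2\<close>.\<close>

lemma multiplicity_geometric_sum_prime:
  fixes p :: nat and Y :: int
  assumes p: "prime p" and Y: "int p dvd Y - 1" and two: "p = 2 \<Longrightarrow> 4 dvd Y - 1"
  shows "multiplicity (int p) (\<Sum>i<p. Y ^ i) = 1"
proof -
  obtain t where "Y - 1 = int p * t"
    using Y by (elim dvdE)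
  then have Yt: "Y = 1 + int p * t"
    by simp
  have pow: "[Y ^ i = 1 + int i * int p * t] (mod (int p)\<^sup>2)" for i
  proof (induction i)
    case (Suc i)
    have "[Y * Y ^ i = Y * (1 + int i * int p * t)] (mod (int p)\<^sup>2)"
      by (rule cong_mult[OF cong_refl Suc.IH])
    moreover have "Y * (1 + int i * int p * t) - (1 + int (Suc i) * int p * t)
        = (int p)\<^sup>2 * (int i * t\<^sup>2)"
      unfolding Yt by (simp add: algebra_simps power2_eq_square)
    then have "[Y * (1 + int i * int p * t) = 1 + int (Suc i) * int p * t] (mod (int p)\<^sup>2)"
      by (simp add: cong_iff_dvd_diff)
    ultimately show ?case
      using cong_trans by fastforce
  qed auto
  \<comment> \<open>For odd \<open>p\<close> the index sum \<open>p * (p - 1) / 2\<close> supplies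
    the factor \<open>p\<close>. For \<open>p = 2\<close> it equals 1, so the factor must come from
    \<open>t\<close>, which is even because \<open>4 dvd Y - 1\<close>.\<close>
  have "int p dvd t * (\<Sum>i<p. int i)"
  proof (cases "p = 2")
    case True
    then have "2 dvd t"
      using two Yt by auto
    then show ?thesis
      using True by simp
  next
    case False
    then have "odd p"
      using p prime_odd_nat prime_ge_2_nat[OF p] by force
    moreover have "2 * (\<Sum>i<n. int i) = int n * (int n - 1)" for n
      by (induction n) (auto simp: algebra_simps)
    then have "int p dvd 2 * (\<Sum>i<p. int i)"
      by simp
    ultimately have "int p dvd (\<Sum>i<p. int i)"
      using coprime_dvd_mult_right_iff[of "int p" 2] by simp
    then show ?thesis
      by simp
  qed
  then have "int p * int p dvd int p * (t * (\<Sum>i<p. int i))"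
    by (rule mult_dvd_mono[OF dvd_refl])
  then have lin: "[int p + int p * (t * (\<Sum>i<p. int i)) = int p + 0] (mod (int p)\<^sup>2)"
    by (intro cong_add) (auto simp: cong_0_iff power2_eq_square)
  have "[(\<Sum>i<p. Y ^ i) = (\<Sum>i<p. 1 + int i * int p * t)] (mod (int p)\<^sup>2)"
    by (intro cong_sum pow)
  moreover have "(\<Sum>i<p. 1 + int i * int p * t) = int p + int p * (t * (\<Sum>i<p. int i))"
    by (simp add: sum.distrib sum_distrib_left mult_ac)
  ultimately have S: "[(\<Sum>i<p. Y ^ i) = int p] (mod (int p)\<^sup>2)"
    using lin by (metis cong_trans add_0_right)
  have "int p dvd (\<Sum>i<p. Y ^ i)"
    using cong_dvd_iff[OF cong_dvd_modulus[OF S, of "int p"]] by simp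
  moreover have "\<not> (int p)\<^sup>2 dvd int p"
    using prime_gt_1_nat[OF p] by (auto simp: power2_eq_square)
  then have "\<not> (int p)\<^sup>2 dvd (\<Sum>i<p. Y ^ i)"
    using cong_dvd_iff[OF S] by blast
  ultimately show ?thesis
    by (intro multiplicity_eqI) (auto simp: numeral_2_eq_2)
qed

text \<open>Each factor \<open>p\<close> of \<open>m\<close> splits off a geometric sum with exactly
  one factor \<open>p\<close>. Once \<open>m\<close> is prime to \<open>p\<close>, the remaining sum
  is congruent to \<open>m\<close> modulo \<open>p\<close> and contributes nothing.\<close>

lemma lifting_the_exponent:
  fixes p m :: nat and X :: int
  assumes p: "prime p" and X: "int p dvd X - 1" and two: "p = 2 \<Longrightarrow> 4 dvd X - 1"
    and "X > 1" and "m > 0"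
  shows "multiplicity (int p) (X ^ m - 1) = multiplicity (int p) (X - 1) + multiplicity p m"
  using \<open>m > 0\<close>
proof (induction m rule: less_induct)
  case (less m)
  have pe: "prime_elem (int p)"
    using p by simp
  have nz: "X ^ n - 1 \<noteq> 0" if "n > 0" for n
    using one_less_power[OF \<open>X > 1\<close> that] by simp
  have dvd: "X - 1 dvd X ^ n - 1" for n
    by (simp add: power_diff_1_eq)
  show ?case
  proof (cases "p dvd m")
    case True
    then obtain n where m: "m = p * n"
      by (elim dvdE)
    with less.prems have "n > 0" "n < m"
      using prime_gt_1_nat[OF p] by auto
    define Y where "Y = X ^ n"
    have fac: "X ^ m - 1 = (Y - 1) * (\<Sum>i<p. Y ^ i)"
      unfolding power_diff_1_eq[symmetric] by (simp add: Y_def m mult.commute flip: power_mult)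
    have "multiplicity (int p) (\<Sum>i<p. Y ^ i) = 1"
    proof (rule multiplicity_geometric_sum_prime[OF p])
      show "int p dvd Y - 1"
        using X dvd[of n] unfolding Y_def by (rule dvd_trans)
      show "4 dvd Y - 1" if "p = 2"
        using two[OF that] dvd[of n] unfolding Y_def by (rule dvd_trans)
    qed
    moreover have "multiplicity (int p) (Y - 1) = multiplicity (int p) (X - 1) + multiplicity p n"
      unfolding Y_def by (rule less.IH) fact+
    moreover have "multiplicity p m = Suc (multiplicity p n)"
      using \<open>n > 0\<close> p prime_gt_0_nat[OF p] m by (auto intro!: multiplicity_times_same)
    ultimately show ?thesis
      using fac nz[OF less.prems] by (simp add: prime_elem_multiplicity_mult_distrib[OF pe])
  next
    case False
    have "[(\<Sum>i<m. X ^ i) = (\<Sum>i<m. 1 ^ i)] (mod int p)"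
      using X by (intro cong_sum cong_pow) (simp add: cong_iff_dvd_diff)
    then have "\<not> int p dvd (\<Sum>i<m. X ^ i)"
      using False by (simp add: cong_dvd_iff cong_0_iff)
    moreover have "X ^ m - 1 = (X - 1) * (\<Sum>i<m. X ^ i)"
      by (rule power_diff_1_eq)
    ultimately show ?thesis
      using False nz[OF less.prems]
      by (simp add: prime_elem_multiplicity_mult_distrib[OF pe] not_dvd_imp_multiplicity_0)
  qed
qed

section \<open>Exponents of a prime in \<open>a ^ k - 1\<close>\<close>

lemma int_fermat_theorem:
  fixes p a :: nat
  assumes "prime p" and "\<not> p dvd a"
  shows "int p dvd int a ^ (p - 1) - 1"
  using fermat_theorem[OF assms] cong_int_iff[of "a ^ (p - 1)" 1 p]
  by (simp add: cong_iff_dvd_diff)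

lemma multiplicity_power_minus_one:
  fixes p a k :: nat
  assumes p: "prime p" "p \<noteq> 2" and "\<not> p dvd a" and "a > 1" and "p - 1 dvd k" and "k > 0"
  shows "multiplicity (int p) (int a ^ k - 1)
    = multiplicity (int p) (int a ^ (p - 1) - 1) + multiplicity p k"
proof -
  obtain m where k: "k = (p - 1) * m"
    using \<open>p - 1 dvd k\<close> by (elim dvdE)
  then have m: "m > 0"
    using \<open>k > 0\<close> by auto
  have p1: "p - 1 > 0"
    using prime_gt_1_nat[OF p(1)] by simp
  then have "\<not> p dvd p - 1"
    using prime_gt_1_nat[OF p(1)] by (auto dest: dvd_imp_le)
  then have "multiplicity p k = multiplicity p m"
    using p p1 m unfolding k
    by (simp add: prime_elem_multiplicity_mult_distrib not_dvd_imp_multiplicity_0)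
  moreover have "multiplicity (int p) ((int a ^ (p - 1)) ^ m - 1)
    = multiplicity (int p) (int a ^ (p - 1) - 1) + multiplicity p m"
    using p int_fermat_theorem[OF p(1) \<open>\<not> p dvd a\<close>] \<open>a > 1\<close> p1 m
    by (intro lifting_the_exponent one_less_power) auto
  ultimately show ?thesis
    by (simp add: k power_mult)
qed

lemma fermat_quotients_bound:
  fixes p :: nat
  assumes p: "prime p" and "p \<ge> 5"
  shows "multiplicity (int p) (2 ^ (p - 1) - 1) + multiplicity (int p) (3 ^ (p - 1) - 1) < p"
    (is "?c < p")
proof -
  have p1: "p - 1 > 0"
    using \<open>p \<ge> 5\<close> by simp
  have pos: "(2::int) ^ (p - 1) - 1 > 0" "(3::int) ^ (p - 1) - 1 > 0"
    using p1 by (simp_all add: one_less_power)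
  have "int p ^ ?c dvd (2 ^ (p - 1) - 1) * (3 ^ (p - 1) - 1)"
    unfolding power_add by (intro mult_dvd_mono multiplicity_dvd)
  then have "int p ^ ?c \<le> (2 ^ (p - 1) - 1) * (3 ^ (p - 1) - 1)"
    using pos by (intro zdvd_imp_le) auto
  also have "\<dots> < 2 ^ (p - 1) * 3 ^ (p - 1)"
    using pos by (intro mult_strict_mono) auto
  also have "\<dots> = (6::int) ^ (p - 1)"
    by (simp flip: power_mult_distrib)
  \<comment> \<open>The base 6 exceeds \<open>p\<close> only for \<open>p = 5\<close>, where
    \<open>6^4 = 1296\<close> is still below \<open>5^5 = 3125\<close>.\<close>
  also have "\<dots> \<le> int p ^ p"
  proof (cases "p = 5")
    case False
    then have "(6::int) ^ (p - 1) \<le> int p ^ (p - 1)"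
      using \<open>p \<ge> 5\<close> by (intro power_mono) auto
    also have "\<dots> \<le> int p ^ p"
      using \<open>p \<ge> 5\<close> by (intro power_increasing) auto
    finally show ?thesis .
  qed auto
  finally show ?thesis
    using \<open>p \<ge> 5\<close> by (subst (asm) power_strict_increasing_iff) auto
qed

section \<open>Consequences of the equation, prime by prime\<close>

context
  fixes q k :: nat and y :: int
  assumes q: "prime q" "odd q" and k: "k > 0" and y: "y > 0"
    and eq: "(2 ^ k - 1) * (3 ^ k - 1) = y ^ q"
begin

text \<open>The exponent of \<open>p\<close> in \<open>y ^ q\<close> is a multiple of
  \<open>q\<close>, and it is positive because \<open>p\<close> divides \<open>y\<close>.\<close>

lemma exponent_le_multiplicity:
  assumes p: "prime p" and dvd: "int p dvd (2 ^ k - 1) * (3 ^ k - 1)"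
  shows "q \<le> multiplicity (int p) (2 ^ k - 1) + multiplicity (int p) (3 ^ k - 1)"
proof -
  have pe: "prime_elem (int p)"
    using p by simp
  have "(2::int) ^ k - 1 \<noteq> 0" "(3::int) ^ k - 1 \<noteq> 0"
    using k by auto
  then have "multiplicity (int p) (2 ^ k - 1) + multiplicity (int p) (3 ^ k - 1)
      = multiplicity (int p) (y ^ q)"
    unfolding eq[symmetric] using pe by (simp add: prime_elem_multiplicity_mult_distrib)
  also have "\<dots> = q * multiplicity (int p) y"
    using pe y by (simp add: prime_elem_multiplicity_power_distrib)
  finally have *: "multiplicity (int p) (2 ^ k - 1) + multiplicity (int p) (3 ^ k - 1)
      = q * multiplicity (int p) y" .
  have "int p dvd y"
    using dvd p unfolding eq by (meson prime_dvd_power prime_nat_int_transfer)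
  then have "multiplicity (int p) y > 0"
    using pe y by (simp add: prime_multiplicity_gt_zero_iff)
  then show ?thesis
    using * by simp
qed

text \<open>For odd \<open>k\<close> the first factor is odd and the second is 2 modulo 4: a single
  factor 2 is too few for a \<open>q\<close>-th power.\<close>

lemma even_exponent: "even k"
proof (rule ccontr)
  assume "odd k"
  then obtain j where j: "k = Suc (2 * j)"
    by (auto elim: oddE)
  have "[(9::int) ^ j = 1 ^ j] (mod 4)"
    by (intro cong_pow) (simp add: cong_def)
  then have "[3 * (9::int) ^ j = 3 * 1] (mod 4)"
    by (intro cong_mult) auto
  then have "(3::int) ^ k mod 4 = 3"
    by (simp add: j power_mult cong_def)
  then have m: "\<not> (4::int) dvd 3 ^ k - 1" and e: "(2::int) dvd 3 ^ k - 1"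
    by presburger+
  have o: "odd ((2::int) ^ k - 1)"
    using k by simp
  have "multiplicity (int 2) (3 ^ k - 1) < 2"
    using m k by (intro multiplicity_lessI) auto
  moreover have "multiplicity (int 2) (2 ^ k - 1) = 0"
    using o by (intro not_dvd_imp_multiplicity_0) auto
  moreover have "q \<le> multiplicity (int 2) (2 ^ k - 1) + multiplicity (int 2) (3 ^ k - 1)"
    using e by (intro exponent_le_multiplicity) auto
  moreover have "q \<ge> 2"
    using prime_ge_2_nat q by blast
  ultimately show False
    by simp
qed

lemma exponent_le_multiplicity_two: "q \<le> multiplicity 2 k + 2"
proof -
  obtain m where m: "k = 2 * m"
    using even_exponent by (elim evenE)
  then have "m > 0"
    using k by simp
  \<comment> \<open>Lifting at 2 requires \<open>4 dvd X - 1\<close>, which fails for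
    \<open>X = 3\<close> but holds for \<open>X = 9\<close>; hence \<open>3 ^ k\<close> is read as
    \<open>9 ^ m\<close>, and 8 is \<open>9 - 1\<close>.\<close>
  have "multiplicity (int 2) (8::int) = 3"
    using multiplicity_prime_power[of "2::int" 3] by simp
  then have "multiplicity (int 2) ((3::int) ^ k - 1) = 3 + multiplicity 2 m"
    using lifting_the_exponent[of 2 9 m] \<open>m > 0\<close> by (simp add: m power_mult)
  moreover have "multiplicity 2 k = Suc (multiplicity 2 m)"
    using \<open>m > 0\<close> unfolding m by (intro multiplicity_times_same) auto
  moreover have "multiplicity (int 2) (2 ^ k - 1) = 0"
    using k by (intro not_dvd_imp_multiplicity_0) simp
  moreover have "q \<le> multiplicity (int 2) (2 ^ k - 1) + multiplicity (int 2) (3 ^ k - 1)"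
    by (intro exponent_le_multiplicity) auto
  ultimately show ?thesis
    by simp
qed

lemma exponent_le_multiplicity_three: "q \<le> multiplicity 3 k + 1"
proof -
  have "\<not> (3::int) dvd 3 ^ k - 1"
    using dvd_power[OF disjI1[OF k], of "3::int"] by presburger
  then have "multiplicity (int 3) (3 ^ k - 1) = 0"
    by (intro not_dvd_imp_multiplicity_0) simp
  \<comment> \<open>Evenness of \<open>k\<close> is the condition \<open>p - 1 dvd k\<close> at
    \<open>p = 3\<close>; the summand 1 is the exponent of 3 in \<open>2^2 - 1\<close>.\<close>
  moreover have *: "multiplicity (int 3) (2 ^ k - 1) = 1 + multiplicity 3 k"
    using multiplicity_power_minus_one[of 3 2 k] even_exponent k by simp
  moreover have "int 3 dvd 2 ^ k - 1"
    using not_dvd_imp_multiplicity_0[of "int 3" "2 ^ k - 1"] * by linarith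
  then have "q \<le> multiplicity (int 3) (2 ^ k - 1) + multiplicity (int 3) (3 ^ k - 1)"
    by (intro exponent_le_multiplicity) auto
  ultimately show ?thesis
    by simp
qed

lemma exponent_less_multiplicity:
  assumes p: "prime p" and p5: "p \<ge> 5" and dvd: "p - 1 dvd k"
  shows "q < p + 2 * multiplicity p k"
proof -
  have ndvd: "\<not> p dvd 2" "\<not> p dvd 3"
    using p5 by (auto dest: dvd_imp_le)
  have "int p dvd 2 ^ (p - 1) - 1"
    using int_fermat_theorem[OF p ndvd(1)] by simp
  also have "(2::int) ^ (p - 1) - 1 dvd 2 ^ k - 1"
    using dvd by (metis dvdE dvd_triv_left power_diff_1_eq power_mult)
  finally have "q \<le> multiplicity (int p) (2 ^ k - 1) + multiplicity (int p) (3 ^ k - 1)"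
    using p by (intro exponent_le_multiplicity) auto
  then show ?thesis
    using multiplicity_power_minus_one[OF p _ ndvd(1) _ dvd k]
      multiplicity_power_minus_one[OF p _ ndvd(2) _ dvd k]
      fermat_quotients_bound[OF p p5] p5 by simp
qed

text \<open>The exponents in \<open>p - 1\<close> and \<open>k\<close> are compared at each prime
  \<open>s\<close>. Those dividing \<open>p - 1\<close> are smaller than \<open>p\<close>, so for
  \<open>s \<ge> 5\<close> induction makes the bound on \<open>q\<close> available at
  \<open>s\<close>.\<close>

lemma prime_minus_one_dvd:
  assumes "prime p" and "p \<le> q"
  shows "p - 1 dvd k"
  using assms
proof (induction p rule: less_induct)
  case (less p)
  have p1: "p - 1 > 0"
    using prime_gt_1_nat[OF less.prems(1)] by simp
  show ?case
  proof (rule multiplicity_le_imp_dvd)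
    fix s :: nat
    assume s: "prime s"
    let ?a = "multiplicity s (p - 1)" and ?v = "multiplicity s k"
    have le: "s ^ ?a \<le> p - 1"
      using p1 by (intro dvd_imp_le multiplicity_dvd)
    show "?a \<le> ?v"
    proof (cases "s dvd p - 1")
      case False
      then show ?thesis
        by (simp add: not_dvd_imp_multiplicity_0)
    next
      case True
      then have "s < p"
        using dvd_imp_le[OF _ p1] p1 by force
      have "s \<noteq> 4"
        using s prime_odd_nat[of s] by force
      then consider "s = 2" | "s = 3" | "s \<ge> 5"
        using prime_ge_2_nat[OF s] by linarith
      then show ?thesis
      proof cases
        case 1
        have "?a < 2 ^ ?a"
          by (rule less_exp)
        \<comment> \<open>The chain is
          \<open>?a + 1 \<le> 2 ^ ?a \<le> p - 1 \<le> q - 1 \<le> ?v + 1\<close>.\<close>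
        then show ?thesis
          using le exponent_le_multiplicity_two less.prems(2) unfolding 1 by linarith
      next
        case 2
        have "?a < 3 ^ ?a"
          by (rule power_gt_expt) simp
        then show ?thesis
          using le exponent_le_multiplicity_three less.prems(2) 2 by simp
      next
        case 3
        have "s - 1 dvd k"
          using less \<open>s < p\<close> s by simp
        then have v: "q < s + 2 * ?v"
          using exponent_less_multiplicity s 3 by simp
        \<comment> \<open>Parity improves \<open>s dvd p - 1\<close> to
          \<open>s \<le> (p - 1) / 2\<close>; inserted into \<open>p \<le> q < s + 2 * ?v\<close>,
          this bounds \<open>p - 1\<close> by \<open>4 * ?v\<close>.\<close>
        have "odd p"
          using less.prems(1) \<open>s < p\<close> 3 by (intro prime_odd_nat) auto
        moreover have "odd s"
          using s 3 by (intro prime_odd_nat) auto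
        ultimately have "2 * s dvd p - 1"
          using True by (intro divides_mult) auto
        then have "2 * s \<le> p - 1"
          using p1 by (rule dvd_imp_le)
        then have p4: "p - 1 \<le> 4 * ?v"
          using v less.prems(2) by simp
        show ?thesis
        proof (rule ccontr)
          \<comment> \<open>Now \<open>5 * ?v \<le> s ^ Suc ?v \<le> p - 1 \<le> 4 * ?v\<close>
            forces \<open>?v = 0\<close>, contradicting \<open>p - 1 > 0\<close>.\<close>
          assume "\<not> ?a \<le> ?v"
          then have "s ^ Suc ?v \<le> s ^ ?a"
            using 3 by (intro power_increasing) auto
          moreover have "5 * ?v \<le> s * s ^ ?v"
            using 3 power_gt_expt[of s ?v] by (intro mult_mono) auto
          moreover have "s ^ Suc ?v > 0" using 3 by simp
          ultimately show False
            using p4 le p1 by simp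
        qed
      qed
    qed
  qed (use p1 in simp)
qed

lemma exponent_dvd: "q dvd k"
proof -
  have "multiplicity q k > 0"
  \<comment> \<open>The general bound starts at 5, so \<open>q = 3\<close> relies on the separate
    bound at 3.\<close>
  proof (cases "q = 3")
    case True
    then show ?thesis
      using exponent_le_multiplicity_three by simp
  next
    case False
    then have "q \<ge> 5"
      using q prime_ge_2_nat[OF q(1)] by (cases "q = 4"; cases "q = 2") auto
    then show ?thesis
      using exponent_less_multiplicity[OF q(1)] prime_minus_one_dvd[OF q(1)] by simp
  qed
  then show ?thesis
    using not_dvd_imp_multiplicity_0 by force
qed

end

theorem theorem5:
  fixes q k :: nat and y :: int
  assumes "prime q" and "odd q"
    and "k > 0" and "y > 0"
    and "(2 ^ k - 1) * (3 ^ k - 1) = y ^ q"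
  shows "q dvd k"
  using assms by (rule exponent_dvd)

end
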